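(* The class of all probability distributions of $p$-values (for all numbers $n$ of $p$-values and all null sets) satisfying the PRDN property is an FDR-consistent dependence class.
   Context: A $p$-value dependence structure $P$ consists of an integer $n\ge1$, a null set $\mathcal N_0\subset\{1,\dots,n\}$ of size $n_0\ge1$, and a joint probability distribution on $[0,1]^n$ of $p$-values $(p_1,\dots,p_n)$ such that each null $p$-value $p_i$, $i\in\mathcal N_0$, is stochastically larger than or equal to the uniform variable on $(0,1)$. PRDN (positive regression dependence within nulls): a (measurable) set $D\subset[0,1]^{n_0}$ is increasing if $x\in D$ and $x\preceq y\preceq1$ coordinatewise imply $y\in D$. $P$ satisfies PRDN if for every increasing set $D\subset[0,1]^{n_0}$ and every $i\in\mathcal N_0$, $\mathbb P\big((p_j)_{j\in\mathcal N_0}\in D\mid p_i\le t\big)$ is non-decreasing in $t\in(0,1]$ (considered for those $t$ with $\mathbb P(p_i\le t)>0$). BH procedure at level $\alpha\in(0,1)$: with ordered $p$-values $p_{(1)}\le\cdots\le p_{(n)}$, let $R=\max\{1\le j\le n:p_{(j)}\le\alpha j/n\}$ ($\max\emptyset=0$) and reject the $R$ hypotheses with $p_j\le\alpha R/n$ (none if $R=0$). With $V$ the number of rejected null $p$-values, $\mathrm{FDR}=\mathbb E[V/\max\{R,1\}]$; $\mathrm{FDR}(\alpha;P)$ denotes the FDR of the BH procedure at level $\alpha$ applied to $p$-values sampled from $P$. A class $\mathcal P$ of dependence structures (possibly with different $n$ and $\mathcal N_0$) is FDR-consistent if $\limsup_{\alpha\to0}\sup_{P\in\mathcal P}\mathrm{FDR}(\alpha;P)=0$.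 *)

theory Defs
  imports "HOL-Probability.Probability"
begin

abbreviation cube :: "nat set \<Rightarrow> (nat \<Rightarrow> real) measure" where
  "cube I \<equiv> PiM I (\<lambda>_. restrict_space borel {0..1})"

record pval_structure =
  num :: nat
  nulls :: "nat set"
  law :: "(nat \<Rightarrow> real) measure"

definition stochastically_ge :: "real measure \<Rightarrow> real measure \<Rightarrow> bool" where
  "stochastically_ge M N \<longleftrightarrow> (\<forall>t. cdf M t \<le> cdf N t)"

(* The constraint on sets (law P) also fixes the sample space, which is the cube
   {1..num P} \<rightarrow>\<^sub>E {0..1}. *)
definition dependence_structure :: "pval_structure \<Rightarrow> bool" where
  "dependence_structure P \<longleftrightarrow>
     num P \<ge> 1 \<and> nulls P \<subseteq> {1..num P} \<and> card (nulls P) \<ge> 1 \<and>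
     prob_space (law P) \<and> sets (law P) = sets (cube {1..num P}) \<and>
     (\<forall>i\<in>nulls P. stochastically_ge (distr (law P) borel (\<lambda>p. p i))
                                   (uniform_measure lborel {0<..<1}))"

definition increasing_set :: "nat set \<Rightarrow> (nat \<Rightarrow> real) set \<Rightarrow> bool" where
  "increasing_set I D \<longleftrightarrow> D \<in> sets (cube I) \<and>
     (\<forall>x\<in>D. \<forall>y\<in>space (cube I). (\<forall>j\<in>I. x j \<le> y j) \<longrightarrow> y \<in> D)"

(* Coordinates in [0,1]^(n_0) are indexed by the null set itself. *)
definition PRDN :: "pval_structure \<Rightarrow> bool" where
  "PRDN P \<longleftrightarrow>
     (\<forall>D. increasing_set (nulls P) D \<longrightarrow> (\<forall>i\<in>nulls P.
        mono_on {t. 0 < t \<and> t \<le> 1 \<and> \<P>(p in law P. p i \<le> t) > 0}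
                (\<lambda>t. \<P>(p in law P. restrict p (nulls P) \<in> D \<bar> p i \<le> t))))"

(* order_stat n p j is the j-th smallest, counting from 1, of p 1, ..., p n. *)
definition order_stat :: "nat \<Rightarrow> (nat \<Rightarrow> real) \<Rightarrow> nat \<Rightarrow> real" where
  "order_stat n p j = sort (map p [1..<Suc n]) ! (j - 1)"

definition BH_R :: "real \<Rightarrow> nat \<Rightarrow> (nat \<Rightarrow> real) \<Rightarrow> nat" where
  "BH_R \<alpha> n p =
     Max (insert 0 {j \<in> {1..n}. order_stat n p j \<le> \<alpha> * real j / real n})"

definition BH_rejected :: "real \<Rightarrow> nat \<Rightarrow> (nat \<Rightarrow> real) \<Rightarrow> nat set" where
  "BH_rejected \<alpha> n p =
     (if BH_R \<alpha> n p = 0 then {}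
      else {j \<in> {1..n}. p j \<le> \<alpha> * real (BH_R \<alpha> n p) / real n})"

definition FDR :: "real \<Rightarrow> pval_structure \<Rightarrow> real" where
  "FDR \<alpha> P =
     (\<integral>p. real (card (BH_rejected \<alpha> (num P) p \<inter> nulls P))
            / real (max (BH_R \<alpha> (num P) p) 1) \<partial>law P)"

(* The supremum is taken in ennreal, so that it is total (and 0 for the empty class). *)
definition FDR_consistent :: "pval_structure set \<Rightarrow> bool" where
  "FDR_consistent C \<longleftrightarrow>
     Limsup (at_right 0) (\<lambda>\<alpha>. SUP P\<in>C. ennreal (FDR \<alpha> P)) = 0"

end

(* Let m be the number of nulls, V the number of false rejections and b = sqrt alpha.  If V > 0,
   then at least V nulls lie below alpha R / n.  Either alpha R / n > b V / m, and then
   V / R < b, or some l = V has at least l nulls below b l / m, which is the rejection event of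
   the Simes test of the nulls at level b.  Under PRDN this event has probability at most b,
   by the telescoping argument of Benjamini and Yekutieli.  Hence the FDR is at most
   2 sqrt alpha, uniformly over the class. *)
theory Submission
  imports Defs
begin

(* The last l for which at least l of the x i are at most t l (0 if there is none) is at
   most k; so k = 0 means that the step-up test with critical values t rejects nothing. *)
definition crossing_le :: "nat set \<Rightarrow> (nat \<Rightarrow> real) \<Rightarrow> nat \<Rightarrow> (nat \<Rightarrow> real) set" where
  "crossing_le I t k =
     {x \<in> space (cube I). \<forall>l\<in>{k<..card I}. card {i\<in>I. x i \<le> t l} < l}"

section \<open>Number of BH rejections against the step-up index\<close>

text \<open>Were the entry at position \<open>k - 1\<close> of the sorted list above
  \<open>c\<close>, sortedness would confine the entries at most \<open>c\<close> to the first
  \<open>k - 1\<close> positions; but sorting preserves their number, which is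
  \<open>k\<close>.\<close>

lemma card_order_stat_le:
  assumes "card {j\<in>{1..n}. p j \<le> c} = k" and "k \<ge> 1"
  shows "order_stat n p k \<le> c"
proof (rule ccontr)
  define ys where "ys = sort (map p [1..<Suc n])"
  assume "\<not> order_stat n p k \<le> c"
  then have gt: "ys ! (k - 1) > c"
    by (simp add: order_stat_def ys_def)
  have "length (filter (\<lambda>y. y \<le> c) ys) = length (filter (\<lambda>j. p j \<le> c) [1..<Suc n])"
    by (simp only: ys_def filter_sort length_sort filter_map length_map o_def)
  also have "\<dots> = card ({j. p j \<le> c} \<inter> set [1..<Suc n])"
    by (rule distinct_length_filter) simp
  also have "{j. p j \<le> c} \<inter> set [1..<Suc n] = {j\<in>{1..n}. p j \<le> c}"
    by auto
  finally have len: "length (filter (\<lambda>y. y \<le> c) ys) = k"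
    using assms by simp
  have "{j. j < length ys \<and> ys ! j \<le> c} \<subseteq> {..<k - 1}"
  proof safe
    fix j assume j: "j < length ys" "ys ! j \<le> c"
    show "j < k - 1"
    proof (rule ccontr)
      assume "\<not> j < k - 1"
      then have "ys ! (k - 1) \<le> ys ! j"
        using j by (intro sorted_nth_mono) (auto simp: ys_def)
      then show False using gt j by simp
    qed
  qed
  then have "card {j. j < length ys \<and> ys ! j \<le> c} \<le> k - 1"
    using card_mono[of "{..<k - 1}"] by fastforce
  then show False
    using len assms by (simp add: length_filter_conv_card)
qed

text \<open>By maximality of R: with k > R rejections, the k-th smallest value is at most \<alpha> R
  / n \<le> \<alpha> k / n, so k itself competes in the maximum. This keeps the false discovery
  proportion at most 1 on the exceptional event.\<close>

lemma card_BH_rejected_le: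
  assumes "\<alpha> \<ge> 0"
  shows "card (BH_rejected \<alpha> n p) \<le> BH_R \<alpha> n p"
proof (cases "BH_R \<alpha> n p = 0")
  case False
  define R where "R = BH_R \<alpha> n p"
  define k where "k = card (BH_rejected \<alpha> n p)"
  have rej: "BH_rejected \<alpha> n p = {j\<in>{1..n}. p j \<le> \<alpha> * real R / real n}"
    using False by (simp add: BH_rejected_def R_def)
  have "k \<le> R"
  proof (rule ccontr)
    assume "\<not> k \<le> R"
    then have k: "R < k" by simp
    have "order_stat n p k \<le> \<alpha> * real R / real n"
      using k by (intro card_order_stat_le) (auto simp: k_def rej)
    also have "\<dots> \<le> \<alpha> * real k / real n"
      using k assms by (intro divide_right_mono mult_left_mono) auto
    finally have le: "order_stat n p k \<le> \<alpha> * real k / real n" .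
    have "k \<le> card {1..n}"
      unfolding k_def rej by (intro card_mono) auto
    then have "k \<in> insert 0 {j \<in> {1..n}. order_stat n p j \<le> \<alpha> * real j / real n}"
      using le k by auto
    then have "k \<le> R"
      unfolding R_def BH_R_def by (intro Max_ge) auto
    then show False using k by simp
  qed
  then show ?thesis by (simp add: k_def R_def)
qed (simp add: BH_rejected_def)

section \<open>The Simes test of the nulls under PRDN\<close>

text \<open>Raising coordinates can only lower each count, so the strict upper bounds on the counts
  survive. This makes PRDN applicable to these sets.\<close>

lemma crossing_le_increasing:
  assumes "finite I"
  shows "increasing_set I (crossing_le I t k)"
proof -
  have meas: "{x \<in> space (cube I). card {i\<in>I. x i \<le> t l} < l} \<in> sets (cube I)" for l
  proof -
    have comp: "(\<lambda>x. x i) \<in> borel_measurable (cube I)" if "i \<in> I" for i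
      using measurable_component_singleton[OF that, of "\<lambda>_. restrict_space borel {0..1::real}"]
      by (auto simp: measurable_restrict_space2_iff)
    \<comment> \<open>Measurability of the count comes from writing it as a finite sum of indicators
      of coordinate events.\<close>
    have "real (card {i\<in>I. x i \<le> t l}) = (\<Sum>i\<in>I. if x i \<le> t l then 1 else 0)"
      for x :: "nat \<Rightarrow> real"
      using assms by (simp add: sum.If_cases Int_def)
    moreover have "(\<lambda>x. \<Sum>i\<in>I. if x i \<le> t l then 1 else 0 :: real)
        \<in> borel_measurable (cube I)"
      using comp by (intro borel_measurable_sum) measurable
    ultimately have "(\<lambda>x. real (card {i\<in>I. x i \<le> t l})) \<in> borel_measurable (cube I)"
      by simp
    then have "{x \<in> space (cube I). real (card {i\<in>I. x i \<le> t l}) < real l} \<in> sets (cube I)"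
      by measurable
    then show ?thesis by simp
  qed
  have "{x \<in> space (cube I). \<forall>l\<in>{k<..card I}. card {i\<in>I. x i \<le> t l} < l}
      \<in> sets (cube I)"
    by (intro sets.sets_Collect_finite_All) (use meas in auto)
  moreover have "y \<in> crossing_le I t k"
    if x: "x \<in> crossing_le I t k" and y: "y \<in> space (cube I)" and le: "\<forall>j\<in>I. x j \<le> y j"
    for x y
  proof -
    have "card {i\<in>I. y i \<le> t l} \<le> card {i\<in>I. x i \<le> t l}" for l
      using assms le by (intro card_mono) force+
    then show ?thesis
      using x y by (fastforce simp: crossing_le_def intro: le_less_trans)
  qed
  ultimately show ?thesis
    unfolding increasing_set_def crossing_le_def[symmetric] by blast
qed

lemma cdf_uniform_01:
  assumes "0 \<le> t" "t \<le> 1"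
  shows "cdf (uniform_measure lborel {0<..<1::real}) t = t"
proof -
  have "{0<..<1} \<inter> {..t} = (if t = 1 then {0<..<1} else {0<..t})"
    using assms by auto
  then show ?thesis
    using assms by (simp add: cdf_def)
qed

text \<open>The rejection event is cut into layers according to the last crossing index k + 1. On
  such a layer at least k + 1 nulls are at most \<open>t (Suc k)\<close>, so its probability is at
  most the sum over the nulls i of its intersections with \<open>L i (Suc k)\<close>, divided by k +
  1. For each fixed i the sum over k telescopes to at most b / m, and there are m nulls.\<close>

lemma Simes_PRDN:
  assumes P: "dependence_structure P" "PRDN P" and b: "0 < b" "b \<le> 1"
  defines "I \<equiv> nulls P"
  defines "t \<equiv> (\<lambda>k::nat. b * real k / real (card I))"
  shows "\<P>(p in law P. restrict p I \<notin> crossing_le I t 0) \<le> b"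
proof -
  define m where "m = card I"
  \<comment> \<open>The events grow from \<open>D 0\<close>, where the Simes test accepts, to
    \<open>D m\<close>, the whole space.\<close>
  define D where "D k = {p \<in> space (law P). restrict p I \<in> crossing_le I t k}" for k
  define L where "L i k = {p \<in> space (law P). p i \<le> t k}" for i k
  interpret prob_space "law P"
    using P by (simp add: dependence_structure_def)
  have I: "I \<subseteq> {1..num P}" "m \<ge> 1" "finite I"
    using P by (auto simp: dependence_structure_def I_def m_def intro: finite_subset)
  have sets_law: "sets (law P) = sets (cube {1..num P})"
    using P by (simp add: dependence_structure_def)
  have restr: "(\<lambda>p. restrict p I) \<in> measurable (law P) (cube I)"
    unfolding measurable_cong_sets[OF sets_law refl]
    using I by (intro measurable_restrict_subset)
  have comp: "(\<lambda>p. p i) \<in> borel_measurable (law P)" if "i \<in> I" for i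
    using measurable_component_singleton[of i "{1..num P}" "\<lambda>_. restrict_space borel {0..1::real}"]
      that I unfolding measurable_cong_sets[OF sets_law refl]
    by (auto simp: measurable_restrict_space2_iff)
  have D_meas [simp]: "D k \<in> events" for k
    using measurable_sets[OF restr, of "crossing_le I t k"] crossing_le_increasing[OF I(3), of t k]
    by (auto simp: D_def increasing_set_def vimage_def Int_def conj_commute)
  have L_meas [simp]: "L i k \<in> events" if "i \<in> I" for i k
    using comp[OF that] unfolding L_def by measurable
  have in_D: "p \<in> D k \<longleftrightarrow> p \<in> space (law P) \<and>
      (\<forall>l\<in>{k<..m}. card {i\<in>I. p i \<le> t l} < l)" for p k
  proof -
    have "restrict p I \<in> space (cube I)" if "p \<in> space (law P)"
      using that restr by (rule measurable_space[rotated])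
    moreover have "{i\<in>I. restrict p I i \<le> t l} = {i\<in>I. p i \<le> t l}" for l
      by auto
    ultimately show ?thesis
      by (auto simp: D_def crossing_le_def m_def)
  qed
  have D_mono: "D k \<subseteq> D (Suc k)" for k
    unfolding subset_iff in_D by auto
  have tpos: "0 < t k" if "k \<ge> 1" for k
    using that I b by (simp add: t_def m_def)
  have t_le: "t k \<le> 1" if "k \<le> m" for k
  proof -
    have "b * real k \<le> 1 * real m"
      using that b by (intro mult_mono) auto
    then show ?thesis using I by (simp add: t_def m_def[symmetric] field_simps)
  qed
  have t_mono: "t k \<le> t (Suc k)" for k
    unfolding t_def using b by (intro divide_right_mono mult_left_mono) auto
  have L_mono: "L i k \<subseteq> L i (Suc k)" for i k
    using t_mono[of k] by (auto simp: L_def)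
  have superuniform: "prob (L i k) \<le> t k" if "i \<in> I" "k \<le> m" for i k
  proof -
    have t0: "0 \<le> t k"
      using b by (simp add: t_def)
    have "prob (L i k) = cdf (distr (law P) borel (\<lambda>p. p i)) (t k)"
      using comp[OF that(1)]
      by (simp add: cdf_def measure_distr L_def vimage_def Int_def conj_commute)
    also have "\<dots> \<le> cdf (uniform_measure lborel {0<..<1}) (t k)"
      using P that by (auto simp: dependence_structure_def stochastically_ge_def I_def)
    also have "\<dots> = t k"
      using t0 t_le that by (intro cdf_uniform_01) auto
    finally show ?thesis .
  qed
  \<comment> \<open>The conditional probability of \<open>D j\<close> given p_i \<le> t_k, with
    value 0 when the condition has probability 0.\<close>
  define c where "c i j k = prob (D j \<inter> L i k) / prob (L i k)" for i j k
  have c_eq: "c i j k =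
      \<P>(p in law P. restrict p (nulls P) \<in> crossing_le I t j \<bar> p i \<le> t k)" for i j k
  proof -
    have "D j \<inter> L i k =
        {p \<in> space (law P). restrict p (nulls P) \<in> crossing_le I t j \<and> p i \<le> t k}"
      by (auto simp: D_def L_def I_def)
    then show ?thesis
      unfolding c_def cond_prob_def by (simp add: L_def[of i k])
  qed
  \<comment> \<open>This is where PRDN enters: the increasing event stays fixed while the
    conditioning threshold rises from t_k to t_{k+1}.\<close>
  have c_step: "c i k k \<le> c i k (Suc k)" if "i \<in> I" "Suc k \<le> m" for i k
  proof (cases "prob (L i k) = 0 \<or> k = 0")
    case True
    \<comment> \<open>The threshold t_0 = 0 lies outside the range of PRDN, but there
      superuniformity makes the condition null, so the left side is 0 by the division
      convention.\<close>
    have "prob (L i 0) = 0"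
      using superuniform[of i 0] that by (simp add: t_def antisym[OF _ measure_nonneg])
    then have "prob (L i k) = 0" using True by auto
    then show ?thesis by (simp add: c_def)
  next
    case False
    then have pos: "prob (L i k) > 0" by (simp add: zero_less_measure_iff)
    also have "prob (L i k) \<le> prob (L i (Suc k))"
      using L_mono L_meas that by (intro finite_measure_mono) auto
    finally have pos': "prob (L i (Suc k)) > 0" .
    have "increasing_set (nulls P) (crossing_le I t k)"
      using crossing_le_increasing I by (simp add: I_def)
    then have "mono_on {t. 0 < t \<and> t \<le> 1 \<and> \<P>(p in law P. p i \<le> t) > 0}
        (\<lambda>s. \<P>(p in law P. restrict p (nulls P) \<in> crossing_le I t k \<bar> p i \<le> s))"
      using P(2) that(1) unfolding PRDN_def I_def by blast
    then show ?thesis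
      unfolding c_eq
      by (rule mono_onD) (use False pos pos' tpos t_le that t_mono in \<open>auto simp: L_def\<close>)
  qed
  \<comment> \<open>Each summand is at most b / m times c(k+1, k+1) - c(k, k+1), for fixed i.
    Replacing c(k, k+1) by the smaller c(k, k), via \<open>c_step\<close>, makes the sum telescope,
    starting from c(0, 0) = 0.\<close>
  have telescope: "(\<Sum>k<j. prob ((D (Suc k) - D k) \<inter> L i (Suc k)) / real (Suc k))
      \<le> b / real m * c i j j" if "i \<in> I" "j \<le> m" for i j
    using that(2)
  proof (induction j)
    case 0
    then show ?case using b by (simp add: c_def)
  next
    case (Suc j)
    let ?L = "L i (Suc j)"
    have eq: "prob ((D (Suc j) - D j) \<inter> ?L) = prob (D (Suc j) \<inter> ?L) - prob (D j \<inter> ?L)"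
    proof -
      have "(D (Suc j) - D j) \<inter> ?L = D (Suc j) \<inter> ?L - D j \<inter> ?L" by auto
      then show ?thesis
        using D_mono[of j] that(1) by (simp only:, subst finite_measure_Diff) auto
    qed
    have "prob ((D (Suc j) - D j) \<inter> ?L) = prob ?L * (c i (Suc j) (Suc j) - c i j (Suc j))"
    proof (cases "prob ?L = 0")
      case True
      moreover have "prob ((D (Suc j) - D j) \<inter> ?L) \<le> prob ?L"
        using that(1) by (intro finite_measure_mono) auto
      ultimately show ?thesis by (simp add: antisym[OF _ measure_nonneg])
    next
      case False
      then show ?thesis by (simp add: eq c_def right_diff_distrib)
    qed
    \<comment> \<open>Superuniformity may be inserted because the difference of conditional
      probabilities of nested events is nonnegative.\<close>
    also have "\<dots> \<le> t (Suc j) * (c i (Suc j) (Suc j) - c i j (Suc j))"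
    proof (intro mult_right_mono superuniform)
      have "prob (D j \<inter> ?L) \<le> prob (D (Suc j) \<inter> ?L)"
        using D_mono[of j] that(1) by (intro finite_measure_mono) auto
      then show "0 \<le> c i (Suc j) (Suc j) - c i j (Suc j)"
        by (simp add: c_def divide_right_mono)
    qed (use Suc that in auto)
    finally have "prob ((D (Suc j) - D j) \<inter> ?L) / real (Suc j)
        \<le> t (Suc j) * (c i (Suc j) (Suc j) - c i j (Suc j)) / real (Suc j)"
      by (intro divide_right_mono) auto
    \<comment> \<open>Linearity of the critical values makes t_{j+1} / (j + 1) = b / m the same
      factor in every layer.\<close>
    also have "\<dots> = b / real m * (c i (Suc j) (Suc j) - c i j (Suc j))"
      by (simp add: t_def m_def del: of_nat_Suc)
    finally have step: "prob ((D (Suc j) - D j) \<inter> ?L) / real (Suc j)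
        \<le> b / real m * (c i (Suc j) (Suc j) - c i j (Suc j))" .
    have "b / real m * c i j j \<le> b / real m * c i j (Suc j)"
      using c_step[OF that(1) Suc.prems] b by (intro mult_left_mono) auto
    then show ?case
      using step Suc by (simp add: right_diff_distrib del: of_nat_Suc)
  qed
  have c_le: "c i j k \<le> 1" if "i \<in> I" for i j k
    unfolding c_def using L_meas[OF that, of k]
    by (intro divide_le_eq_1[THEN iffD2])
       (auto simp: zero_less_measure_iff intro!: finite_measure_mono)
  have layer: "prob (D (Suc k) - D k)
      \<le> (\<Sum>i\<in>I. prob ((D (Suc k) - D k) \<inter> L i (Suc k)) / real (Suc k))" for k
  proof -
    let ?E = "D (Suc k) - D k"
    have E: "?E \<inter> L i (Suc k) \<in> events" if "i \<in> I" for i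
      using that by (intro sets.Int sets.Diff D_meas L_meas)
    \<comment> \<open>A pointwise Markov-type inequality, integrated below.\<close>
    have "real (Suc k) * indicator ?E p \<le> (\<Sum>i\<in>I. indicator (?E \<inter> L i (Suc k)) p :: real)"
      for p
    proof (cases "p \<in> ?E")
      case True
      then obtain l where l: "l \<in> {k<..m}" "\<not> card {i\<in>I. p i \<le> t l} < l"
        by (auto simp: in_D)
      \<comment> \<open>Failure of \<open>D k\<close> gives a crossing above k, and
        \<open>D (Suc k)\<close> excludes all crossings above k + 1.\<close>
      then have "l = Suc k"
        using True by (auto simp: in_D dest: le_neq_implies_less)
      then have "Suc k \<le> card {i\<in>I. p i \<le> t (Suc k)}"
        using l by simp
      also have "real \<dots> = (\<Sum>i\<in>I. indicator (?E \<inter> L i (Suc k)) p)"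
      proof -
        have "indicator (?E \<inter> L i (Suc k)) p = (if p i \<le> t (Suc k) then 1 else 0 :: real)" for i
          using True by (auto simp: L_def in_D indicator_def)
        then show ?thesis using I by (simp add: sum.If_cases Int_def)
      qed
      finally show ?thesis using True by simp
    qed (auto intro!: sum_nonneg)
    then have "(\<integral>p. real (Suc k) * indicator ?E p \<partial>law P)
        \<le> (\<integral>p. (\<Sum>i\<in>I. indicator (?E \<inter> L i (Suc k)) p) \<partial>law P)"
      by (intro integral_mono Bochner_Integration.integrable_sum integrable_mult_right
            integrable_real_indicator)
         (auto simp: less_top[symmetric] E)
    also have "(\<integral>p. (\<Sum>i\<in>I. indicator (?E \<inter> L i (Suc k)) p) \<partial>law P)
        = (\<Sum>i\<in>I. prob (?E \<inter> L i (Suc k)))"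
      by (subst Bochner_Integration.integral_sum)
         (auto intro!: integrable_real_indicator sum.cong simp: less_top[symmetric] E)
    finally have "real (Suc k) * prob ?E \<le> (\<Sum>i\<in>I. prob (?E \<inter> L i (Suc k)))"
      using sets.Int_space_eq2[OF sets.Diff[OF D_meas D_meas]] by simp
    then show ?thesis
      by (simp add: sum_divide_distrib[symmetric] field_simps)
  qed
  have "prob (D j - D 0) \<le> (\<Sum>k<j. prob (D (Suc k) - D k))" for j
  proof (induction j)
    case (Suc j)
    have "prob (D (Suc j) - D 0) \<le> prob ((D j - D 0) \<union> (D (Suc j) - D j))"
      by (intro finite_measure_mono sets.Un sets.Diff D_meas) auto
    also have "\<dots> \<le> prob (D j - D 0) + prob (D (Suc j) - D j)"
      by (intro measure_Un_le sets.Diff D_meas)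
    finally show ?case using Suc by simp
  qed simp
  moreover have "{p \<in> space (law P). restrict p I \<notin> crossing_le I t 0} = D m - D 0"
  proof -
    \<comment> \<open>The range \<open>{m<..m}\<close> of the defining condition is empty.\<close>
    have "D m = space (law P)"
      by (auto simp: in_D)
    then show ?thesis
      by (simp only: D_def[of 0]) auto
  qed
  ultimately have "\<P>(p in law P. restrict p I \<notin> crossing_le I t 0)
      \<le> (\<Sum>k<m. prob (D (Suc k) - D k))"
    by simp
  also have "\<dots> \<le> (\<Sum>k<m. \<Sum>i\<in>I. prob ((D (Suc k) - D k) \<inter> L i (Suc k)) / real (Suc k))"
    by (intro sum_mono layer)
  also have "\<dots> = (\<Sum>i\<in>I. \<Sum>k<m. prob ((D (Suc k) - D k) \<inter> L i (Suc k)) / real (Suc k))"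
    by (rule sum.swap)
  also have "\<dots> \<le> (\<Sum>i\<in>I. b / real m)"
  proof (intro sum_mono)
    fix i assume i: "i \<in> I"
    have "b / real m * c i m m \<le> b / real m * 1"
      using c_le[OF i] b by (intro mult_left_mono) auto
    then show "(\<Sum>k<m. prob ((D (Suc k) - D k) \<inter> L i (Suc k)) / real (Suc k)) \<le> b / real m"
      using telescope[OF i order_refl] by simp
  qed
  also have "\<dots> = b"
    using I(2) by (auto simp: m_def)
  finally show ?thesis .
qed

section \<open>From the Simes bound to the FDR\<close>

text \<open>With m nulls and a Simes test at level b, acceptance forces \<alpha> R / n > b V / m,
  whence V / R < (\<alpha> / b)(m / n) \<le> \<alpha> / b. The choice b = sqrt \<alpha> balances
  this bound against the Simes rejection probability b.\<close>

lemma FDP_le: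
  assumes I: "I \<subseteq> {1..n}" "card I \<ge> 1" and \<alpha>: "\<alpha> > 0"
    and p: "restrict p I \<in> crossing_le I (\<lambda>k. sqrt \<alpha> * real k / real (card I)) 0"
  shows "real (card (BH_rejected \<alpha> n p \<inter> I)) / real (max (BH_R \<alpha> n p) 1) \<le> sqrt \<alpha>"
proof (cases "card (BH_rejected \<alpha> n p \<inter> I) = 0")
  case False
  define V where "V = card (BH_rejected \<alpha> n p \<inter> I)"
  define R where "R = BH_R \<alpha> n p"
  have fin: "finite I" using I by (auto intro: finite_subset)
  have V: "1 \<le> V" "V \<le> card I"
    using False card_mono[OF fin, of "BH_rejected \<alpha> n p \<inter> I"] by (auto simp: V_def)
  have R: "1 \<le> R"
    using False by (cases "R = 0") (auto simp: R_def BH_rejected_def)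
  have n: "card I \<le> n" "n > 0"
    using card_mono[OF _ I(1)] I(2) by auto
  have "\<not> \<alpha> * real R / real n \<le> sqrt \<alpha> * real V / real (card I)"
  proof
    assume "\<alpha> * real R / real n \<le> sqrt \<alpha> * real V / real (card I)"
    then have "BH_rejected \<alpha> n p \<inter> I
        \<subseteq> {i\<in>I. restrict p I i \<le> sqrt \<alpha> * real V / real (card I)}"
      using R by (auto simp: BH_rejected_def R_def[symmetric])
    moreover have "finite {i\<in>I. restrict p I i \<le> sqrt \<alpha> * real V / real (card I)}"
      using fin by simp
    ultimately have "V \<le> card {i\<in>I. restrict p I i \<le> sqrt \<alpha> * real V / real (card I)}"
      by (metis V_def card_mono)
    moreover have "\<forall>l\<in>{0<..card I}.
        card {i\<in>I. restrict p I i \<le> sqrt \<alpha> * real l / real (card I)} < l"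
      using p unfolding crossing_le_def by blast
    moreover have "V \<in> {0<..card I}"
      using V by simp
    ultimately show False
      using leD by blast
  qed
  then have "sqrt \<alpha> * real V * real n < \<alpha> * real R * real (card I)"
    using n I by (simp add: field_simps)
  \<comment> \<open>Uses m \<le> n, which removes the proportion of nulls from the bound.\<close>
  also have "\<dots> \<le> \<alpha> * real R * real n"
    using n \<alpha> by (intro mult_left_mono) auto
  finally have "sqrt \<alpha> * real V < sqrt \<alpha> * (sqrt \<alpha> * real R)"
    using n \<alpha> by (simp add: mult.assoc[symmetric])
  then have "real V < sqrt \<alpha> * real R"
    using \<alpha> by simp
  then show ?thesis
    using R by (simp add: V_def[symmetric] R_def[symmetric] max_def field_simps)
qed (use \<alpha> in simp)

text \<open>The false discovery proportion is at most 1 on the Simes rejection event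
  \<open>A\<close> and at most sqrt \<alpha> off it; each case contributes at most sqrt \<alpha> to
  the expectation.\<close>

lemma FDR_PRDN_le:
  assumes P: "dependence_structure P" "PRDN P" and \<alpha>: "0 < \<alpha>" "\<alpha> \<le> 1"
  shows "FDR \<alpha> P \<le> 2 * sqrt \<alpha>"
proof -
  define I where "I = nulls P"
  define t where "t = (\<lambda>k::nat. sqrt \<alpha> * real k / real (card I))"
  define A where "A = {p \<in> space (law P). restrict p I \<notin> crossing_le I t 0}"
  define F where "F p = real (card (BH_rejected \<alpha> (num P) p \<inter> I))
      / real (max (BH_R \<alpha> (num P) p) 1)" for p
  interpret prob_space "law P"
    using P by (simp add: dependence_structure_def)
  have I: "I \<subseteq> {1..num P}" "card I \<ge> 1" "finite I"
    using P by (auto simp: dependence_structure_def I_def intro: finite_subset)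
  have "prob A \<le> sqrt \<alpha>"
    using Simes_PRDN[OF P, of "sqrt \<alpha>"] \<alpha> by (simp add: A_def I_def t_def)
  have sets_law: "sets (law P) = sets (cube {1..num P})"
    using P by (simp add: dependence_structure_def)
  have restr: "(\<lambda>p. restrict p I) \<in> measurable (law P) (cube I)"
    unfolding measurable_cong_sets[OF sets_law refl]
    using I by (intro measurable_restrict_subset)
  have A: "A \<in> events"
  proof -
    have "crossing_le I t 0 \<in> sets (cube I)"
      using crossing_le_increasing[OF I(3)] by (simp add: increasing_set_def)
    then show ?thesis
      unfolding A_def using restr by measurable
  qed
  have F_le: "F p \<le> sqrt \<alpha> + indicator A p" if "p \<in> space (law P)" for p
  proof (cases "p \<in> A")
    case True
    have "card (BH_rejected \<alpha> (num P) p \<inter> I) \<le> card (BH_rejected \<alpha> (num P) p)"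
      by (intro card_mono) (auto simp: BH_rejected_def)
    also have "\<dots> \<le> BH_R \<alpha> (num P) p"
      using \<alpha> by (intro card_BH_rejected_le) auto
    finally have "F p \<le> 1"
      unfolding F_def by (simp add: max_def)
    moreover have "sqrt \<alpha> \<ge> 0" using \<alpha> by simp
    ultimately show ?thesis using True by (simp add: add_increasing)
  next
    case False
    then have "F p \<le> sqrt \<alpha>"
      unfolding F_def using that I \<alpha> by (intro FDP_le) (auto simp: A_def t_def)
    then show ?thesis using False by simp
  qed
  have "FDR \<alpha> P = (\<integral>p. F p \<partial>law P)"
    by (simp add: FDR_def F_def I_def)
  \<comment> \<open>Integrability is checked for the nonnegative majorant alone: were
    \<open>F\<close> not integrable, its integral would be 0 by convention and the bound would still
    hold.\<close>
  also have "\<dots> \<le> (\<integral>p. sqrt \<alpha> + indicator A p \<partial>law P)"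
    using A \<alpha> F_le
    by (intro integral_mono_AE')
       (auto simp: emeasure_eq_measure F_def intro!: Bochner_Integration.integrable_add)
  also have "\<dots> = sqrt \<alpha> + prob A"
    using A by (subst Bochner_Integration.integral_add) (auto simp: emeasure_eq_measure prob_space)
  finally show ?thesis
    using \<open>prob A \<le> sqrt \<alpha>\<close> by simp
qed

theorem corollary1p4:
  "FDR_consistent {P. dependence_structure P \<and> PRDN P}"
proof -
  let ?C = "{P. dependence_structure P \<and> PRDN P}"
  have "eventually (\<lambda>\<alpha>::real. \<alpha> \<in> {0<..<1}) (at_right 0)"
    by (intro eventually_at_right_real) simp
  \<comment> \<open>The bound depends neither on n nor on the null set or the law, so it passes to
    the supremum.\<close>
  then have "eventually (\<lambda>\<alpha>. (SUP P\<in>?C. ennreal (FDR \<alpha> P)) \<le> ennreal (2 * sqrt \<alpha>)) (at_right 0)"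
    by eventually_elim (auto intro!: SUP_least ennreal_leI FDR_PRDN_le)
  then have "Limsup (at_right 0) (\<lambda>\<alpha>. SUP P\<in>?C. ennreal (FDR \<alpha> P))
      \<le> Limsup (at_right 0) (\<lambda>\<alpha>. ennreal (2 * sqrt \<alpha>))"
    by (rule Limsup_mono)
  also have "\<dots> = 0"
  proof (rule lim_imp_Limsup)
    have "((\<lambda>\<alpha>. 2 * sqrt \<alpha>) \<longlongrightarrow> 2 * sqrt 0) (at_right 0)"
      by (intro tendsto_intros)
    then show "((\<lambda>\<alpha>. ennreal (2 * sqrt \<alpha>)) \<longlongrightarrow> 0) (at_right 0)"
      using tendsto_ennrealI by fastforce
  qed simp
  finally show ?thesis
    by (simp add: FDR_consistent_def)
qed

end
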